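(* Let $A\in\mathbb{R}^{n\times m}$, $k\in\{2,\dots,\min\{n,m\}\}$, $W=\begin{bmatrix} 0 & A \\ A^\top & 0 \end{bmatrix}\in\mathbb{S}^{n+m}$. Let $Z^\star$ be an optimal solution, with objective value $p^\star$, of the semidefinite program $$\max\ \tfrac12\mathrm{tr}(WZ)\quad\text{s.t.}\quad \mathcal{A}(Z)=b,\ \mathcal{B}(Z)\le 0_q,\ Z\ge0 \text{ entrywise},\ Z\in\mathbb{S}^{n+m}_+,$$ where $\mathcal{A}(Z)=b$ encodes $\mathrm{tr}(Z_{UU})=k$, $Z_{UU}1_n=1_n$, $\mathrm{tr}(Z_{VV})=k$, $Z_{VV}1_m=1_m$, and $\mathcal{B}$ collects $q$ valid inequalities as described in the context. Consider dual variables $y_U\in\mathbb{R}^n$, $y_V\in\mathbb{R}^m$, $\alpha_U,\alpha_V\in\mathbb{R}$, $t\in\mathbb{R}^q$ with $t\ge0_q$, and $Q\in\mathbb{S}^{n+m}$ with $Q\ge0$ entrywise; set $\lambda=[\alpha_U,y_U,\alpha_V,y_V]$ and $$\tilde S=-\tfrac12W+\mathcal{A}^\top(\lambda)+\mathcal{B}^\top(t)-Q.$$ Then $$p^\star\le y_U^\top1_n+y_V^\top1_m+k(\alpha_U+\alpha_V)-2\sum_{i:\ \lambda_i(\tilde S)<0}\lambda_i(\tilde S),$$ where $\lambda_i(\tilde S)$ denote the eigenvalues of $\tilde S$ (counted with multiplicity).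
   Context: $\mathbb{S}^N$ is the space of real symmetric $N\times N$ matrices, $\mathbb{S}^N_+$ its positive semidefinite members, $1_N$ and $0_N$ the all-ones and all-zeros vectors in $\mathbb{R}^N$, $I_N$ the identity, and $\langle X,Y\rangle=\mathrm{tr}(Y^\top X)$. Matrices $Z\in\mathbb{S}^{n+m}$ are partitioned as $Z=\begin{bmatrix} Z_{UU} & Z_{UV} \\ Z_{UV}^\top & Z_{VV} \end{bmatrix}$ with $Z_{UU}\in\mathbb{S}^n$, $Z_{VV}\in\mathbb{S}^m$. The linear map $\mathcal{A}:\mathbb{S}^{n+m}\to\mathbb{R}^{n+m+2}$ is $\mathcal{A}(Z)=\big[\langle Z_{UU},I_n\rangle;\ \tfrac12(Z_{UU}+Z_{UU}^\top)1_n;\ \langle Z_{VV},I_m\rangle;\ \tfrac12(Z_{VV}+Z_{VV}^\top)1_m\big]$ and $b=[k;1_n;k;1_m]$. Its adjoint is $$\mathcal{A}^\top(\lambda)=\begin{bmatrix} \tfrac12(1_ny_U^\top+y_U1_n^\top)+\alpha_UI_n & 0 \\ 0 & \tfrac12(1_my_V^\top+y_V1_m^\top)+\alpha_VI_m \end{bmatrix}.$$ The linear map $\mathcal{B}:\mathbb{S}^{n+m}\to\mathbb{R}^q$ collects $q$ inequalities, written in the form $\mathcal{B}(Z)\le0_q$, each chosen from the following families: $(Z_{UU})_{ij}\le(Z_{UU})_{ii}$ for distinct $i,j$; $(Z_{VV})_{ij}\le(Z_{VV})_{ii}$ for distinct $i,j$; $(Z_{UU})_{ij}+(Z_{UU})_{ih}\le(Z_{UU})_{ii}+(Z_{UU})_{jh}$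 for distinct $i,j,h$; $(Z_{VV})_{ij}+(Z_{VV})_{ih}\le(Z_{VV})_{ii}+(Z_{VV})_{jh}$ for distinct $i,j,h$. $\mathcal{B}^\top:\mathbb{R}^q\to\mathbb{S}^{n+m}$ is its adjoint with respect to the trace inner product. *)

theory Defs
  imports
    "HOL-Analysis.Analysis"
    "HOL-Computational_Algebra.Polynomial"
begin

text \<open>
  An \<open>n \<times> m\<close> real matrix is a \<open>real^'m^'n\<close> (row index first in \<open>A $ i $ j\<close>), with
  \<open>n = CARD('n)\<close> and \<open>m = CARD('m)\<close>. Matrices of order \<open>n + m\<close> are indexed by \<open>'n + 'm\<close>, so that
  the \<open>Inl\<close> indices form the \<open>U\<close> part and the \<open>Inr\<close> indices the \<open>V\<close> part.
  The trace inner product is the library's inner product of \<open>real^'m^'n\<close>.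
\<close>

lemma inner_eq_trace:
  fixes X Y :: "real^'m^'n"
  shows "X \<bullet> Y = trace (transpose Y ** X)"
proof -
  have "X \<bullet> Y = (\<Sum>i\<in>UNIV. \<Sum>j\<in>UNIV. X $ i $ j * Y $ i $ j)"
    by (simp add: inner_vec_def)
  also have "\<dots> = (\<Sum>j\<in>UNIV. \<Sum>i\<in>UNIV. X $ i $ j * Y $ i $ j)"
    by (rule sum.swap)
  also have "\<dots> = trace (transpose Y ** X)"
    by (simp add: trace_def transpose_def matrix_matrix_mult_def mult.commute)
  finally show ?thesis .
qed

definition symmetric_mat :: "real^'a^'a \<Rightarrow> bool" where
  "symmetric_mat X \<longleftrightarrow> transpose X = X"

definition psd :: "real^'a^'a \<Rightarrow> bool" where
  "psd X \<longleftrightarrow> symmetric_mat X \<and> (\<forall>x. 0 \<le> x \<bullet> (X *v x))"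

definition entrywise_nonneg :: "real^'b^'a \<Rightarrow> bool" where
  "entrywise_nonneg X \<longleftrightarrow> (\<forall>i j. 0 \<le> X $ i $ j)"

definition block_UU :: "real^('n::finite + 'm::finite)^('n + 'm) \<Rightarrow> real^'n^'n" where
  "block_UU Z = (\<chi> i j. Z $ Inl i $ Inl j)"

definition block_VV :: "real^('n::finite + 'm::finite)^('n + 'm) \<Rightarrow> real^'m^'m" where
  "block_VV Z = (\<chi> i j. Z $ Inr i $ Inr j)"

definition block_mat ::
    "real^'n::finite^'n \<Rightarrow> real^'m::finite^'n \<Rightarrow> real^'n^'m \<Rightarrow> real^'m^'m \<Rightarrow> real^('n + 'm)^('n + 'm)" where
  "block_mat P Q R S = (\<chi> a b.
     case a of
       Inl i \<Rightarrow> (case b of Inl j \<Rightarrow> P $ i $ j | Inr j \<Rightarrow> Q $ i $ j)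
     | Inr i \<Rightarrow> (case b of Inl j \<Rightarrow> R $ i $ j | Inr j \<Rightarrow> S $ i $ j))"

definition outer :: "real^'a \<Rightarrow> real^'b \<Rightarrow> real^'b^'a" where
  "outer u v = (\<chi> i j. u $ i * v $ j)"

definition W_mat :: "real^'m::finite^'n::finite \<Rightarrow> real^('n + 'm)^('n + 'm)" where
  "W_mat A = block_mat 0 A (transpose A) 0"


subsection \<open>The equality constraints\<close>

text \<open>
  The space \<open>\<real>\<^sup>n\<^sup>+\<^sup>m\<^sup>+\<^sup>2\<close> is represented as a product, with components in the order
  \<open>[\<alpha>\<^sub>U; y\<^sub>U; \<alpha>\<^sub>V; y\<^sub>V]\<close>; \<open>1\<close> of a vector type is the all-ones vector (the identity
  matrix is \<open>mat 1\<close>).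
\<close>

definition A_map ::
    "real^('n::finite + 'm::finite)^('n + 'm) \<Rightarrow> real \<times> (real^'n) \<times> real \<times> (real^'m)" where
  "A_map Z =
    (block_UU Z \<bullet> mat 1,
     ((1/2) *\<^sub>R (block_UU Z + transpose (block_UU Z))) *v 1,
     block_VV Z \<bullet> mat 1,
     ((1/2) *\<^sub>R (block_VV Z + transpose (block_VV Z))) *v 1)"

definition b_vec :: "nat \<Rightarrow> real \<times> (real^'n) \<times> real \<times> (real^'m)" where
  "b_vec k = (real k, 1, real k, 1)"

fun A_adj ::
    "real \<times> (real^'n::finite) \<times> real \<times> (real^'m::finite) \<Rightarrow> real^('n + 'm)^('n + 'm)" where
  "A_adj (\<alpha>U, yU, \<alpha>V, yV) =
    block_mat ((1/2) *\<^sub>R (outer 1 yU + outer yU 1) + \<alpha>U *\<^sub>R mat 1) 0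
              0 ((1/2) *\<^sub>R (outer 1 yV + outer yV 1) + \<alpha>V *\<^sub>R mat 1)"

lemma sum_UNIV_Plus:
  fixes f :: "'n::finite + 'm::finite \<Rightarrow> real"
  shows "sum f UNIV = (\<Sum>i\<in>UNIV. f (Inl i)) + (\<Sum>j\<in>UNIV. f (Inr j))"
  by (subst UNIV_Plus_UNIV[symmetric], subst sum.Plus) auto

lemma inner_block_mat:
  "block_mat P 0 0 S \<bullet> Z = P \<bullet> block_UU Z + S \<bullet> block_VV Z"
  by (simp add: inner_vec_def sum_UNIV_Plus block_mat_def block_UU_def block_VV_def)

lemma inner_sym_outer:
  fixes X :: "real^'a^'a" and y :: "real^'a"
  shows "((1/2) *\<^sub>R (outer 1 y + outer y 1)) \<bullet> X =
         y \<bullet> (((1/2) *\<^sub>R (X + transpose X)) *v 1)"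
proof -
  have "((1/2) *\<^sub>R (outer 1 y + outer y 1)) \<bullet> X =
      (\<Sum>i\<in>UNIV. \<Sum>j\<in>UNIV. y $ j * X $ i $ j / 2 + y $ i * X $ i $ j / 2)"
    unfolding inner_vec_def by (intro sum.cong refl) (simp add: inner_vec_def outer_def field_simps)
  also have "\<dots> = (\<Sum>i\<in>UNIV. \<Sum>j\<in>UNIV. y $ j * X $ i $ j / 2)
      + (\<Sum>i\<in>UNIV. \<Sum>j\<in>UNIV. y $ i * X $ i $ j / 2)"
    by (simp only: sum.distrib)
  also have "(\<Sum>i\<in>UNIV. \<Sum>j\<in>UNIV. y $ j * X $ i $ j / 2) =
      (\<Sum>i\<in>UNIV. \<Sum>j\<in>UNIV. y $ i * X $ j $ i / 2)"
    by (rule sum.swap)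
  also have "\<dots> + (\<Sum>i\<in>UNIV. \<Sum>j\<in>UNIV. y $ i * X $ i $ j / 2) =
      (\<Sum>i\<in>UNIV. \<Sum>j\<in>UNIV. y $ i * ((X $ i $ j + X $ j $ i) / 2))"
    unfolding sum.distrib[symmetric] by (intro sum.cong refl) (simp add: field_simps)
  also have "\<dots> = y \<bullet> (((1/2) *\<^sub>R (X + transpose X)) *v 1)"
    unfolding inner_vec_def
    by (intro sum.cong refl) (simp add: matrix_vector_mult_def transpose_def sum_distrib_left)
  finally show ?thesis .
qed

lemma A_adj_adjoint: "A_adj l \<bullet> Z = l \<bullet> A_map Z"
proof -
  obtain aU yU aV yV where l: "l = (aU, yU, aV, yV)" by (cases l) auto
  show ?thesis
    by (simp only: l A_map_def A_adj.simps inner_block_mat inner_add_left inner_sym_outer[symmetric]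
        inner_commute[of "mat 1"] inner_scaleR_left inner_Pair inner_real_def add_ac)
qed


subsection \<open>The inequality constraints\<close>

datatype ('n, 'm) ineq =
    PairU 'n 'n | PairV 'm 'm | TriangleU 'n 'n 'n | TriangleV 'm 'm 'm

fun ineq_distinct :: "('n, 'm) ineq \<Rightarrow> bool" where
  "ineq_distinct (PairU i j) \<longleftrightarrow> i \<noteq> j"
| "ineq_distinct (PairV i j) \<longleftrightarrow> i \<noteq> j"
| "ineq_distinct (TriangleU i j h) \<longleftrightarrow> distinct [i, j, h]"
| "ineq_distinct (TriangleV i j h) \<longleftrightarrow> distinct [i, j, h]"

text \<open>Left-hand side minus right-hand side of an inequality, which then reads \<open>ineq_val c Z \<le> 0\<close>.\<close>

fun pair_val :: "real^'a^'a \<Rightarrow> 'a \<Rightarrow> 'a \<Rightarrow> real" where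
  "pair_val X i j = X $ i $ j - X $ i $ i"

fun triangle_val :: "real^'a^'a \<Rightarrow> 'a \<Rightarrow> 'a \<Rightarrow> 'a \<Rightarrow> real" where
  "triangle_val X i j h = (X $ i $ j + X $ i $ h) - (X $ i $ i + X $ j $ h)"

fun ineq_val :: "('n::finite, 'm::finite) ineq \<Rightarrow> real^('n + 'm)^('n + 'm) \<Rightarrow> real" where
  "ineq_val (PairU i j) Z = pair_val (block_UU Z) i j"
| "ineq_val (PairV i j) Z = pair_val (block_VV Z) i j"
| "ineq_val (TriangleU i j h) Z = triangle_val (block_UU Z) i j h"
| "ineq_val (TriangleV i j h) Z = triangle_val (block_VV Z) i j h"

text \<open>
  Vectors in \<open>\<real>\<^sup>q\<close> are lists of length \<open>q\<close>, where \<open>q = 0\<close> is allowed; the list \<open>cs\<close> of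
  inequalities determines the map.
\<close>

definition B_map :: "('n::finite, 'm::finite) ineq list \<Rightarrow> real^('n + 'm)^('n + 'm) \<Rightarrow> real list" where
  "B_map cs Z = map (\<lambda>c. ineq_val c Z) cs"

definition B_adj :: "('n::finite, 'm::finite) ineq list \<Rightarrow> real list \<Rightarrow> real^('n + 'm)^('n + 'm)" where
  "B_adj cs t = (THE M. symmetric_mat M \<and>
     (\<forall>Z. symmetric_mat Z \<longrightarrow> M \<bullet> Z = (\<Sum>l<length cs. t ! l * B_map cs Z ! l)))"

lemma transpose_inner: "transpose X \<bullet> transpose Y = X \<bullet> (Y :: real^'a^'a)"
  unfolding inner_vec_def transpose_def
  by (simp add: inner_vec_def) (rule sum.swap)

lemma ex1_symmetric_representer:
  fixes f :: "real^'a^'a \<Rightarrow> real"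
  assumes f: "linear f"
  shows "\<exists>!M. symmetric_mat M \<and> (\<forall>Z. symmetric_mat Z \<longrightarrow> M \<bullet> Z = f Z)"
proof (rule ex_ex1I)
  define M0 where "M0 = adjoint f 1"
  have M0: "M0 \<bullet> Z = f Z" for Z
    using adjoint_works[OF f, of Z 1] by (simp add: M0_def inner_commute)
  let ?M = "(1/2) *\<^sub>R (M0 + transpose M0)"
  have "symmetric_mat ?M"
    by (simp add: symmetric_mat_def transpose_def vec_eq_iff)
  moreover have "?M \<bullet> Z = f Z" if "symmetric_mat Z" for Z
    using that transpose_inner[of M0 Z] M0[of Z]
    by (simp add: symmetric_mat_def inner_add_left)
  ultimately show "\<exists>M. symmetric_mat M \<and> (\<forall>Z. symmetric_mat Z \<longrightarrow> M \<bullet> Z = f Z)"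
    by blast
next
  fix M N
  assume M: "symmetric_mat M \<and> (\<forall>Z. symmetric_mat Z \<longrightarrow> M \<bullet> Z = f Z)"
    and N: "symmetric_mat N \<and> (\<forall>Z. symmetric_mat Z \<longrightarrow> N \<bullet> Z = f Z)"
  have "symmetric_mat (M - N)"
    using M N by (simp add: symmetric_mat_def transpose_def vec_eq_iff)
  with M N have "(M - N) \<bullet> (M - N) = 0"
    by (simp add: inner_diff_left)
  then show "M = N" by simp
qed

lemma linear_ineq_val: "linear (ineq_val c)"
  by (cases c; rule linearI)
    (simp_all add: block_UU_def block_VV_def algebra_simps)

lemma B_adj_adjoint:
  "symmetric_mat (B_adj cs t)"
  "symmetric_mat Z \<Longrightarrow> B_adj cs t \<bullet> Z = (\<Sum>l<length cs. t ! l * B_map cs Z ! l)"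
proof -
  have "linear (\<lambda>Z. \<Sum>l<length cs. t ! l * ineq_val (cs ! l) Z)"
    by (rule linear_compose_sum)
      (auto intro!: linearI simp: linear_add[OF linear_ineq_val]
        linear_cmul[OF linear_ineq_val] algebra_simps)
  then have "linear (\<lambda>Z. \<Sum>l<length cs. t ! l * B_map cs Z ! l)"
    by (simp add: B_map_def cong: sum.cong_simp)
  from theI'[OF ex1_symmetric_representer[OF this]]
  show "symmetric_mat (B_adj cs t)"
    "symmetric_mat Z \<Longrightarrow> B_adj cs t \<bullet> Z = (\<Sum>l<length cs. t ! l * B_map cs Z ! l)"
    by (simp_all add: B_adj_def)
qed


subsection \<open>The semidefinite program\<close>

definition sdp_feasible ::
    "nat \<Rightarrow> ('n::finite, 'm::finite) ineq list \<Rightarrow> real^('n + 'm)^('n + 'm) \<Rightarrow> bool" where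
  "sdp_feasible k cs Z \<longleftrightarrow>
     A_map Z = b_vec k \<and> (\<forall>v\<in>set (B_map cs Z). v \<le> 0) \<and> entrywise_nonneg Z \<and> psd Z"

definition sdp_objective :: "real^'m::finite^'n::finite \<Rightarrow> real^('n + 'm)^('n + 'm) \<Rightarrow> real" where
  "sdp_objective A Z = (1/2) * trace (W_mat A ** Z)"

lemma half_add_self: "(1/2) *\<^sub>R (X + X) = (X :: real^'b^'a)"
  by (simp add: vec_eq_iff)

lemma inner_mat_1: "X \<bullet> mat 1 = trace (X :: real^'a^'a)"
  by (simp add: inner_eq_trace transpose_mat)

lemma A_map_eq_b_vec_iff:
  assumes "symmetric_mat Z"
  shows "A_map Z = b_vec k \<longleftrightarrow>
    trace (block_UU Z) = real k \<and> block_UU Z *v 1 = 1 \<and>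
    trace (block_VV Z) = real k \<and> block_VV Z *v 1 = 1"
proof -
  have Z: "Z $ i $ j = Z $ j $ i" for i j
    using arg_cong[OF assms[unfolded symmetric_mat_def], of "\<lambda>X. X $ j $ i"]
    by (simp add: transpose_def)
  have "transpose (block_UU Z) = block_UU Z" "transpose (block_VV Z) = block_VV Z"
    by (simp_all add: vec_eq_iff transpose_def block_UU_def block_VV_def Z)
  then show ?thesis
    by (simp only: A_map_def b_vec_def prod.inject half_add_self inner_mat_1)
qed


subsection \<open>Eigenvalues with multiplicity\<close>

definition charpoly :: "real^'a^'a \<Rightarrow> real poly" where
  "charpoly S = det (\<chi> i j. (if i = j then [:0, 1:] else 0) - [:S $ i $ j:])"

definition eigenvalues :: "real^'a^'a \<Rightarrow> real multiset" where
  "eigenvalues S = proots (charpoly S)"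

lemma poly_charpoly: "poly (charpoly S) c = det (c *\<^sub>R mat 1 - S)"
  unfolding charpoly_def det_def
  by (simp add: poly_sum poly_prod of_int_poly mat_def if_distrib[of "\<lambda>p. poly p c"]
      if_distrib[of "\<lambda>x. c * x"] cong: if_cong)

lemma poly_charpoly_eq_0_iff:
  "poly (charpoly S) c = 0 \<longleftrightarrow> (\<exists>v. v \<noteq> 0 \<and> S *v v = c *\<^sub>R v)"
proof -
  have e: "(c *\<^sub>R mat 1 - S) *v v = c *\<^sub>R v - S *v v" for v
    by (simp add: matrix_vector_mult_diff_rdistrib flip: scaleR_matrix_vector_assoc)
  have "det (c *\<^sub>R mat 1 - S) = 0 \<longleftrightarrow> \<not> (\<forall>v. (c *\<^sub>R mat 1 - S) *v v = 0 \<longrightarrow> v = 0)"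
    by (metis invertible_det_nz invertible_left_inverse matrix_left_invertible_ker)
  then show ?thesis
    by (auto simp: poly_charpoly e)
qed

lemma charpoly_nonzero: "charpoly S \<noteq> 0"
proof
  assume "charpoly S = 0"
  then obtain v where v: "v \<noteq> 0" "S *v v = (onorm ((*v) S) + 1) *\<^sub>R v"
    using poly_charpoly_eq_0_iff[of S "onorm ((*v) S) + 1"] by auto
  have "norm (S *v v) \<le> onorm ((*v) S) * norm v"
    by (intro onorm matrix_vector_mul_bounded_linear)
  moreover have "0 \<le> onorm ((*v) S)"
    by (intro onorm_pos_le matrix_vector_mul_bounded_linear)
  moreover have "0 < norm v"
    using v(1) by simp
  ultimately show False
    unfolding v(2) by (simp add: distrib_right)
qed

lemma eigenvalues_iff: "c \<in># eigenvalues S \<longleftrightarrow> (\<exists>v. v \<noteq> 0 \<and> S *v v = c *\<^sub>R v)"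
  by (simp add: eigenvalues_def charpoly_nonzero poly_charpoly_eq_0_iff)

end

theory Submission
  imports Defs
begin

text \<open>
  For feasible \<open>Z\<close>, pairing \<open>St\<close> with \<open>Z\<close> and dropping the terms of known sign gives
  \<open>p \<le> \<lambda> \<bullet> b - St \<bullet> Z\<close>. In an orthonormal eigenbasis \<open>v\<^sub>i\<close> of \<open>St\<close>,
  \<open>St \<bullet> Z\<close> is the sum of the \<open>\<lambda>\<^sub>i (v\<^sub>i \<bullet> Z v\<^sub>i)\<close>, and \<open>0 \<le> v\<^sub>i \<bullet> Z v\<^sub>i \<le> 2\<close>
  because the diagonal blocks of \<open>Z\<close> are doubly stochastic, hence have eigenvalues at most \<open>1\<close>,
  and a positive semidefinite matrix is dominated by twice its block diagonal.
\<close>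

section \<open>Spectral theorem for real symmetric matrices\<close>

lemma symmetric_mat_inner:
  fixes S :: "real^'a^'a"
  assumes "symmetric_mat S"
  shows "x \<bullet> (S *v y) = (S *v x) \<bullet> y"
  using assms by (metis dot_lmul_matrix symmetric_mat_def vector_transpose_matrix)

text \<open>A maximiser of the Rayleigh quotient on the compact unit sphere of \<open>T\<close> is
  an eigenvector. Working inside an invariant subspace \<open>T\<close> lets eigenvectors be split
  off one at a time.\<close>

lemma symmetric_mat_eigenvector:
  fixes S :: "real^'a^'a"
  assumes S: "symmetric_mat S" and T: "subspace T" "(*v) S ` T \<subseteq> T" "T \<noteq> {0}"
  obtains c x where "x \<in> T" "norm x = 1" "S *v x = c *\<^sub>R x"
proof -
  obtain w where w: "w \<in> T" "w \<noteq> 0"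
    using T(1,3) subspace_0 by blast
  then have "(1 / norm w) *\<^sub>R w \<in> T \<inter> sphere 0 1"
    using T(1) by (simp add: subspace_scale)
  then have ne: "T \<inter> sphere 0 1 \<noteq> {}"
    by blast
  have cpt: "compact (T \<inter> sphere 0 1)"
    using T(1) by (intro closed_Int_compact closed_subspace) auto
  have cont: "continuous_on (T \<inter> sphere 0 1) (\<lambda>x. x \<bullet> (S *v x))"
    by (intro continuous_intros)
  obtain x where x: "x \<in> T" "norm x = 1"
    and max: "\<And>y. y \<in> T \<Longrightarrow> norm y = 1 \<Longrightarrow> y \<bullet> (S *v y) \<le> x \<bullet> (S *v x)"
    using continuous_attains_sup[OF cpt ne cont] by auto
  define c where "c = x \<bullet> (S *v x)"
  have bound: "y \<bullet> (S *v y) \<le> c * (y \<bullet> y)" if "y \<in> T" for y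
  proof (cases "y = 0")
    case False
    have "((1 / norm y) *\<^sub>R y) \<bullet> (S *v ((1 / norm y) *\<^sub>R y)) \<le> c"
      unfolding c_def using False that T(1) by (intro max) (simp_all add: subspace_scale)
    then have "(y \<bullet> (S *v y)) / (norm y)\<^sup>2 \<le> c"
      by (simp add: matrix_vector_mult_scaleR power2_eq_square)
    with False show ?thesis
      by (simp add: divide_le_eq power2_norm_eq_inner)
  qed simp
  \<comment> \<open>First-order optimality: the residual \<open>r\<close> lies in \<open>T\<close>, and moving from \<open>x\<close> in direction \<open>r\<close> forces \<open>r = 0\<close>.\<close>
  define r where "r = c *\<^sub>R x - S *v x"
  have "r \<in> T"
    unfolding r_def using x T by (intro subspace_diff subspace_scale) auto
  define a where "a = c * (r \<bullet> r) - r \<bullet> (S *v r)"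
  \<comment> \<open>By \<open>bound\<close>, the gap
    \<open>c * (y \<bullet> y) - y \<bullet> (S *v y)\<close> is nonnegative on \<open>T\<close>,
    and it vanishes at \<open>x\<close>. Along \<open>y = x + s *\<^sub>R r\<close> its linear
    coefficient is \<open>2 * (r \<bullet> r)\<close> and its quadratic one is
    \<open>a\<close>.\<close>
  have "0 \<le> 2 * s * (r \<bullet> r) + s\<^sup>2 * a" for s
  proof -
    have "x + s *\<^sub>R r \<in> T"
      using x \<open>r \<in> T\<close> T(1) by (intro subspace_add subspace_scale) auto
    from bound[OF this] have "0 \<le> c * ((x + s *\<^sub>R r) \<bullet> (x + s *\<^sub>R r))
        - (x + s *\<^sub>R r) \<bullet> (S *v (x + s *\<^sub>R r))"
      by simp
    also have "\<dots> = (c * (x \<bullet> x) - x \<bullet> (S *v x))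
        + 2 * s * (c * (x \<bullet> r) - (S *v x) \<bullet> r) + s\<^sup>2 * a"
      unfolding a_def matrix_vector_right_distrib matrix_vector_mult_scaleR inner_add_left
        inner_add_right inner_scaleR_left inner_scaleR_right inner_commute[of r x]
        inner_commute[of r "S *v x"] symmetric_mat_inner[OF S, of x r]
      by (simp add: power2_eq_square algebra_simps)
    also have "c * (x \<bullet> x) - x \<bullet> (S *v x) = 0"
      using x(2) by (simp add: c_def dot_square_norm)
    also have "c * (x \<bullet> r) - (S *v x) \<bullet> r = r \<bullet> r"
      by (subst (3) r_def) (simp add: inner_diff_left)
    finally show ?thesis by simp
  qed
  \<comment> \<open>The step taken is \<open>s = - (e * (r \<bullet> r))\<close>. This
    \<open>e\<close> is positive with \<open>e * a \<le> 1\<close> whatever the sign of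
    \<open>a\<close>, so the factor \<open>e * a - 2\<close> below is negative.\<close>
  moreover define e where "e = 1 / (\<bar>a\<bar> + 1)"
  ultimately have "0 \<le> 2 * - (e * (r \<bullet> r)) * (r \<bullet> r) + (- (e * (r \<bullet> r)))\<^sup>2 * a"
    by blast
  also have "\<dots> = e * (r \<bullet> r)\<^sup>2 * (e * a - 2)"
    by (simp add: power2_eq_square algebra_simps)
  finally have "0 \<le> e * (r \<bullet> r)\<^sup>2 * (e * a - 2)" .
  moreover have "0 < e" "e * a \<le> 1"
    by (auto simp: e_def divide_le_eq)
  ultimately have "r \<bullet> r = 0"
    by (auto simp: zero_le_mult_iff mult_le_0_iff)
  then have "S *v x = c *\<^sub>R x"
    by (simp add: r_def)
  with x that show thesis by blast
qed

text \<open>Induction on the dimension of \<open>T\<close>: after a unit eigenvector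
  \<open>x\<close> is split off, its orthogonal complement within \<open>T\<close> is again
  invariant because \<open>S\<close> is self-adjoint.\<close>

lemma symmetric_mat_eigenbasis_subspace:
  fixes S :: "real^'a^'a"
  assumes S: "symmetric_mat S" and "subspace T" "(*v) S ` T \<subseteq> T"
  shows "\<exists>B. pairwise orthogonal B \<and> (\<forall>x\<in>B. norm x = 1 \<and> (\<exists>c. S *v x = c *\<^sub>R x)) \<and> span B = T"
  using assms(2,3)
proof (induction "dim T" arbitrary: T rule: less_induct)
  case less
  show ?case
  proof (cases "T = {0}")
    case True
    then show ?thesis by (intro exI[of _ "{}"]) auto
  next
    case False
    then obtain c x where x: "x \<in> T" "norm x = 1" "S *v x = c *\<^sub>R x"
      using symmetric_mat_eigenvector[OF S less.prems] by blast
    define T' where "T' = T \<inter> {y. x \<bullet> y = 0}"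
    have sub: "subspace T'"
      unfolding T'_def by (intro subspace_inter less.prems(1) subspace_hyperplane)
    have inv: "(*v) S ` T' \<subseteq> T'"
      using less.prems(2) symmetric_mat_inner[OF S, of x] x(3) by (auto simp: T'_def)
    have "x \<notin> T'"
      using x(2) by (auto simp: T'_def)
    then have "T' \<subset> T"
      using x(1) unfolding T'_def by blast
    then have "dim T' < dim T"
      using sub less.prems(1) by (intro dim_psubset) (simp add: span_eq_iff[THEN iffD2])
    from less.hyps[OF this sub inv] obtain B where B: "pairwise orthogonal B"
      "\<forall>x\<in>B. norm x = 1 \<and> (\<exists>c. S *v x = c *\<^sub>R x)" "span B = T'"
      by blast
    have "pairwise orthogonal (insert x B)"
      using B(1) span_superset[of B] unfolding B(3) T'_def
      by (auto simp: pairwise_insert orthogonal_def inner_commute)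
    moreover have "span (insert x B) = T"
    proof
      show "span (insert x B) \<subseteq> T"
        using x(1) span_superset[of B] B(3) less.prems(1) by (intro span_minimal) (auto simp: T'_def)
      show "T \<subseteq> span (insert x B)"
      proof
        fix y assume y: "y \<in> T"
        have "y - (x \<bullet> y) *\<^sub>R x \<in> T'"
          using x y less.prems(1)
          by (auto simp: T'_def inner_diff_right dot_square_norm intro!: subspace_diff subspace_scale)
        then show "y \<in> span (insert x B)"
          unfolding B(3)[symmetric] span_breakdown_eq by blast
      qed
    qed
    ultimately show ?thesis
      using B(2) x by (intro exI[of _ "insert x B"]) auto
  qed
qed

theorem symmetric_mat_orthogonal_diagonalization:
  fixes S :: "real^'a^'a"
  assumes "symmetric_mat S"
  obtains V :: "real^'a^'a" and d :: "'a \<Rightarrow> real"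
  where "orthogonal_matrix V" "\<And>i. S *v column i V = d i *\<^sub>R column i V"
proof -
  obtain B where B: "pairwise orthogonal B"
    "\<forall>x\<in>B. norm x = 1 \<and> (\<exists>c. S *v x = c *\<^sub>R x)" "span B = UNIV"
    using symmetric_mat_eigenbasis_subspace[OF assms subspace_UNIV] by auto
  have "0 \<notin> B"
    using B(2) by force
  then have "independent B"
    using B(1) by (rule pairwise_orthogonal_independent[rotated])
  then have fin: "finite B" and "card B = CARD('a)"
    using B(3) basis_card_eq_dim[of B UNIV] by (auto simp: independent_imp_finite)
  \<comment> \<open>The basis has as many elements as the index type, so it can be indexed by that
    type and its members become the columns of a square matrix.\<close>
  then obtain f where f: "bij_betw f (UNIV :: 'a set) B"
    using finite_same_card_bij[OF finite_class.finite_UNIV fin] by metis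
  define V :: "real^'a^'a" where "V = (\<chi> i j. f j $ i)"
  have col: "column j V = f j" for j
    by (simp add: V_def column_def vec_eq_iff)
  have fB: "f j \<in> B" for j
    using f by (auto simp: bij_betw_def)
  have "orthogonal_matrix V"
    unfolding orthogonal_matrix_orthonormal_columns col
    using B(1,2) fB f by (auto simp: pairwise_def bij_betw_def inj_eq)
  moreover have "\<forall>j. \<exists>c. S *v f j = c *\<^sub>R f j"
    using B(2) fB by blast
  then obtain d where "\<And>j. S *v f j = d j *\<^sub>R f j"
    by metis
  ultimately show thesis
    using that[of V d] by (simp add: col)
qed

section \<open>Eigenvalues and trace inner product in an orthonormal eigenbasis\<close>

context
  fixes S V :: "real^'a^'a" and d :: "'a \<Rightarrow> real"
  assumes V: "orthogonal_matrix V" and eig: "\<And>i. S *v column i V = d i *\<^sub>R column i V"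
begin

text \<open>The right-hand side is \<open>V\<close> times the diagonal matrix of \<open>d\<close>,
  multiplied out.\<close>

lemma mult_eigenvector_matrix: "S ** V = (\<chi> i j. d j * V $ i $ j)"
proof -
  have "(S ** V) $ i $ j = (S *v column j V) $ i" for i j
    by (simp add: matrix_matrix_mult_def matrix_vector_mult_def column_def)
  then show ?thesis
    by (simp only: eig vec_eq_iff) (simp add: column_def)
qed

lemma eigenvalues_orthogonal_diagonalization:
  "eigenvalues S = image_mset d (mset_set UNIV)"
proof -
  \<comment> \<open>A real polynomial is determined by its values, so the determinants can be
    computed over the reals; the invertible factor \<open>V\<close> then cancels.\<close>
  have "poly (charpoly S) c = poly (\<Prod>i\<in>UNIV. [:- d i, 1:]) c" for c
  proof -
    let ?D = "(\<chi> i j. if i = j then c - d i else 0) :: real^'a^'a"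
    have "(c *\<^sub>R mat 1 - S) ** V = V ** ?D"
    proof -
      have "(c *\<^sub>R mat 1 - S) ** V = c *\<^sub>R (V :: real^'a^'a) - S ** V"
        unfolding vec_eq_iff
        by (simp add: matrix_matrix_mult_def mat_def left_diff_distrib sum_subtractf
            if_distrib[of "(*) _"] if_distrib[of "\<lambda>a. a * _"] cong: if_cong)
      also have "\<dots> = V ** ?D"
        unfolding mult_eigenvector_matrix
        by (simp add: vec_eq_iff matrix_matrix_mult_def if_distrib[of "(*) _"] algebra_simps
            cong: if_cong)
      finally show ?thesis .
    qed
    from arg_cong[OF this, of det]
    have eq: "det (c *\<^sub>R mat 1 - S) * det V = det ?D * det V"
      by (simp only: det_mul mult.commute)
    have "det V \<noteq> 0"
      using det_orthogonal_matrix[OF V] by auto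
    with eq have "det (c *\<^sub>R mat 1 - S) = det ?D"
      by simp
    also have "\<dots> = (\<Prod>i\<in>UNIV. c - d i)"
      by (subst det_diagonal) simp_all
    finally have "det (c *\<^sub>R mat 1 - S) = (\<Prod>i\<in>UNIV. c - d i)" .
    then show ?thesis
      by (simp add: poly_charpoly poly_prod)
  qed
  then have "poly (charpoly S) = poly (\<Prod>i\<in>UNIV. [:- d i, 1:])"
    by (rule ext)
  then have "charpoly S = (\<Prod>i\<in>UNIV. [:- d i, 1:])"
    by (simp only: poly_eq_poly_eq_iff)
  then show ?thesis
    by (simp add: eigenvalues_def proots_prod sum_unfold_sum_mset)
qed

text \<open>Right multiplication by an orthogonal matrix preserves the trace inner product, so
  \<open>S ** V\<close> and \<open>Z ** V\<close> can be paired column by column.\<close>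

lemma inner_orthogonal_diagonalization:
  "S \<bullet> Z = (\<Sum>i\<in>UNIV. d i * (column i V \<bullet> (Z *v column i V)))"
proof -
  have "(S ** V) \<bullet> (Z ** V) = trace (transpose V ** (transpose Z ** (S ** V)))"
    by (simp add: inner_eq_trace matrix_transpose_mul matrix_mul_assoc)
  also have "\<dots> = trace ((transpose Z ** (S ** V)) ** transpose V)"
    by (rule trace_mul_sym)
  also have "\<dots> = trace (transpose Z ** (S ** (V ** transpose V)))"
    by (simp add: matrix_mul_assoc)
  also have "\<dots> = S \<bullet> Z"
    using V by (simp add: orthogonal_matrix_def inner_eq_trace)
  finally have "S \<bullet> Z = (S ** V) \<bullet> (Z ** V)" ..
  also have "\<dots> = (\<Sum>j\<in>UNIV. \<Sum>i\<in>UNIV. d j * V $ i $ j * (Z ** V) $ i $ j)"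
    by (subst sum.swap) (simp add: inner_vec_def mult_eigenvector_matrix)
  also have "\<dots> = (\<Sum>j\<in>UNIV. d j * (column j V \<bullet> (Z *v column j V)))"
    by (simp add: inner_vec_def sum_distrib_left column_def matrix_matrix_mult_def
        matrix_vector_mult_def mult.assoc)
  finally show ?thesis .
qed

end

text \<open>In the eigenbasis each \<open>d i\<close> is weighted by a number in
  \<open>[0, c]\<close>. A nonnegative \<open>d i\<close> contributes at least \<open>0\<close>, a
  negative one at least \<open>c * d i\<close>.\<close>

lemma inner_ge_negative_eigenvalues:
  fixes S Z :: "real^'a^'a"
  assumes S: "symmetric_mat S" and Z: "psd Z"
    and bound: "\<And>x. x \<bullet> (Z *v x) \<le> c * (x \<bullet> x)"
  shows "c * (\<Sum>\<mu> \<in># filter_mset (\<lambda>\<mu>. \<mu> < 0) (eigenvalues S). \<mu>) \<le> S \<bullet> Z"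
proof -
  obtain V d where V: "orthogonal_matrix V" and eig: "\<And>i. S *v column i V = d i *\<^sub>R column i V"
    using symmetric_mat_orthogonal_diagonalization[OF S] by metis
  have unit: "column i V \<bullet> column i V = 1" for i
    using V by (simp add: orthogonal_matrix_orthonormal_columns dot_square_norm)
  have "(\<Sum>\<mu> \<in># filter_mset (\<lambda>\<mu>. \<mu> < 0) (eigenvalues S). \<mu>) = (\<Sum>i\<in>{i. d i < 0}. d i)"
    by (simp add: eigenvalues_orthogonal_diagonalization[OF V eig] filter_mset_image_mset
        sum_unfold_sum_mset)
  also have "\<dots> = (\<Sum>i\<in>UNIV. if d i < 0 then d i else 0)"
    by (simp add: sum.If_cases)
  finally have "c * (\<Sum>\<mu> \<in># filter_mset (\<lambda>\<mu>. \<mu> < 0) (eigenvalues S). \<mu>) =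
      (\<Sum>i\<in>UNIV. c * (if d i < 0 then d i else 0))"
    by (simp only: sum_distrib_left)
  also have "\<dots> \<le> (\<Sum>i\<in>UNIV. d i * (column i V \<bullet> (Z *v column i V)))"
  proof (rule sum_mono)
    fix i
    have "0 \<le> column i V \<bullet> (Z *v column i V)" "column i V \<bullet> (Z *v column i V) \<le> c"
      using Z bound[of "column i V"] by (auto simp: psd_def unit)
    then show "c * (if d i < 0 then d i else 0) \<le> d i * (column i V \<bullet> (Z *v column i V))"
      by (auto simp: mult.commute[of c] intro: mult_left_mono_neg)
  qed
  also have "\<dots> = S \<bullet> Z"
    by (rule inner_orthogonal_diagonalization[OF V eig, symmetric])
  finally show ?thesis .
qed

section \<open>Bounding the quadratic form of a feasible matrix\<close>

lemma stochastic_quadratic_form_le: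
  fixes M :: "real^'a^'a"
  assumes M: "symmetric_mat M" "entrywise_nonneg M" "M *v 1 = 1"
  shows "x \<bullet> (M *v x) \<le> x \<bullet> x"
proof -
  have row: "(\<Sum>j\<in>UNIV. M $ i $ j) = 1" for i
    using arg_cong[OF M(3), of "\<lambda>v. v $ i"] by (simp add: matrix_vector_mult_def)
  have sym: "M $ i $ j = M $ j $ i" for i j
    using M(1) by (simp add: symmetric_mat_def transpose_def vec_eq_iff)
  have "x \<bullet> (M *v x) = (\<Sum>i\<in>UNIV. \<Sum>j\<in>UNIV. M $ i $ j * (x $ i * x $ j))"
    by (simp add: inner_vec_def matrix_vector_mult_def sum_distrib_left mult_ac)
  \<comment> \<open>The inequality of arithmetic and geometric means, weighted by the nonnegative
    entries of \<open>M\<close>.\<close>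
  also have "\<dots> \<le> (\<Sum>i\<in>UNIV. \<Sum>j\<in>UNIV. M $ i $ j * ((x $ i)\<^sup>2 / 2 + (x $ j)\<^sup>2 / 2))"
    using M(2) sum_squares_bound
    by (intro sum_mono mult_left_mono) (auto simp: entrywise_nonneg_def field_simps)
  also have "\<dots> = (\<Sum>i\<in>UNIV. \<Sum>j\<in>UNIV. M $ i $ j * ((x $ i)\<^sup>2 / 2)) +
      (\<Sum>i\<in>UNIV. \<Sum>j\<in>UNIV. M $ i $ j * ((x $ j)\<^sup>2 / 2))"
    by (simp add: distrib_left sum.distrib)
  \<comment> \<open>By symmetry the column sums are row sums, so both halves equal
    \<open>(x \<bullet> x) / 2\<close>.\<close>
  also have "(\<Sum>i\<in>UNIV. \<Sum>j\<in>UNIV. M $ i $ j * ((x $ j)\<^sup>2 / 2)) =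
      (\<Sum>i\<in>UNIV. \<Sum>j\<in>UNIV. M $ i $ j * ((x $ i)\<^sup>2 / 2))"
    by (subst sum.swap) (simp add: sym)
  also have "(\<Sum>i\<in>UNIV. \<Sum>j\<in>UNIV. M $ i $ j * ((x $ i)\<^sup>2 / 2)) = (x \<bullet> x) / 2"
    unfolding sum_distrib_right[symmetric] row
    by (simp add: inner_vec_def power2_eq_square sum_divide_distrib)
  finally show ?thesis by simp
qed

text \<open>Flipping the sign of the \<open>V\<close> part of \<open>x\<close> negates exactly the
  cross terms. Adding the two forms leaves twice the block-diagonal part, and the flipped form is
  nonnegative.\<close>

lemma psd_quadratic_form_le_blocks:
  fixes Z :: "real^('n::finite + 'm::finite)^('n + 'm)"
  assumes "psd Z"
  shows "x \<bullet> (Z *v x) \<le> 2 * ((\<chi> i. x $ Inl i) \<bullet> (block_UU Z *v (\<chi> i. x $ Inl i)) +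
    (\<chi> i. x $ Inr i) \<bullet> (block_VV Z *v (\<chi> i. x $ Inr i)))" (is "_ \<le> ?b")
proof -
  let ?x' = "(\<chi> a. case a of Inl i \<Rightarrow> x $ Inl i | Inr j \<Rightarrow> - x $ Inr j) :: real^('n + 'm)"
  have "0 \<le> ?x' \<bullet> (Z *v ?x')"
    using assms by (simp add: psd_def)
  moreover have "x \<bullet> (Z *v x) + ?x' \<bullet> (Z *v ?x') = ?b"
    by (simp add: inner_vec_def matrix_vector_mult_def sum_UNIV_Plus block_UU_def block_VV_def
        distrib_left right_diff_distrib sum.distrib sum_negf sum_subtractf)
  ultimately show ?thesis by linarith
qed

lemma sdp_feasible_quadratic_form_le:
  fixes Z :: "real^('n::finite + 'm::finite)^('n + 'm)"
  assumes "sdp_feasible k cs Z"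
  shows "x \<bullet> (Z *v x) \<le> 2 * (x \<bullet> x)"
proof -
  have Z: "A_map Z = b_vec k" "entrywise_nonneg Z" "psd Z" "symmetric_mat Z"
    using assms by (auto simp: sdp_feasible_def psd_def)
  have "symmetric_mat (block_UU Z)" "symmetric_mat (block_VV Z)"
    using Z(4) by (simp_all add: symmetric_mat_def transpose_def vec_eq_iff block_UU_def block_VV_def)
  moreover have "entrywise_nonneg (block_UU Z)" "entrywise_nonneg (block_VV Z)"
    using Z(2) by (simp_all add: entrywise_nonneg_def block_UU_def block_VV_def)
  moreover have "block_UU Z *v 1 = 1" "block_VV Z *v 1 = 1"
    using Z(1) by (simp_all add: A_map_eq_b_vec_iff[OF Z(4)])
  ultimately have le: "u \<bullet> (block_UU Z *v u) \<le> u \<bullet> u" "v \<bullet> (block_VV Z *v v) \<le> v \<bullet> v" for u v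
    by (simp_all add: stochastic_quadratic_form_le)
  have "x \<bullet> x = (\<chi> i. x $ Inl i) \<bullet> (\<chi> i. x $ Inl i) + (\<chi> i. x $ Inr i) \<bullet> (\<chi> i. x $ Inr i)"
    by (simp add: inner_vec_def sum_UNIV_Plus)
  moreover note psd_quadratic_form_le_blocks[OF Z(3), of x]
  moreover note add_mono[OF le(1)[of "\<chi> i. x $ Inl i"] le(2)[of "\<chi> i. x $ Inr i"]]
  ultimately show ?thesis by simp
qed

section \<open>Weak duality with the spectral correction\<close>

lemma symmetric_mat_W_mat: "symmetric_mat (W_mat A)"
  by (simp add: symmetric_mat_def transpose_def W_mat_def block_mat_def vec_eq_iff split: sum.split)

lemma symmetric_mat_A_adj: "symmetric_mat (A_adj l)"
  by (cases l) (auto simp: symmetric_mat_def transpose_def block_mat_def outer_def mat_def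
      vec_eq_iff split: sum.split)

theorem theorem4p5:
  fixes A :: "real^'m::finite^'n::finite"
    and k :: nat
    and cs :: "('n, 'm) ineq list"
    and Zs :: "real^('n + 'm)^('n + 'm)"
    and p :: real
    and yU :: "real^'n" and yV :: "real^'m"
    and \<alpha>U \<alpha>V :: real
    and t :: "real list"
    and Q St :: "real^('n + 'm)^('n + 'm)"
  assumes k: "2 \<le> k" "k \<le> min CARD('n) CARD('m)"
    and cs: "\<forall>c\<in>set cs. ineq_distinct c"
    and opt: "is_arg_max (sdp_objective A) (sdp_feasible k cs) Zs"
    and p: "p = sdp_objective A Zs"
    and t: "length t = length cs" "\<forall>v\<in>set t. 0 \<le> v"
    and Q: "symmetric_mat Q" "entrywise_nonneg Q"
    and St: "St = - (1/2) *\<^sub>R W_mat A + A_adj (\<alpha>U, yU, \<alpha>V, yV) + B_adj cs t - Q"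
  shows "p \<le> yU \<bullet> 1 + yV \<bullet> 1 + real k * (\<alpha>U + \<alpha>V)
           - 2 * (\<Sum>\<mu> \<in># filter_mset (\<lambda>\<mu>. \<mu> < 0) (eigenvalues St). \<mu>)"
proof -
  have feas: "sdp_feasible k cs Zs"
    using opt by (simp add: is_arg_max_def)
  then have Z: "A_map Zs = b_vec k" "\<forall>v\<in>set (B_map cs Zs). v \<le> 0" "entrywise_nonneg Zs" "psd Zs"
    and symZ: "symmetric_mat Zs"
    by (auto simp: sdp_feasible_def psd_def)
  have "symmetric_mat St"
    using symmetric_mat_W_mat[of A] symmetric_mat_A_adj[of "(\<alpha>U, yU, \<alpha>V, yV)"]
      B_adj_adjoint(1)[of cs t] Q(1)
    unfolding St by (simp add: symmetric_mat_def transpose_def vec_eq_iff)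
  \<comment> \<open>\<open>St\<close> need not be positive semidefinite, so
    \<open>St \<bullet> Zs\<close> may be negative; the factor \<open>2\<close> is the bound on the
    quadratic form of \<open>Zs\<close>.\<close>
  then have low: "2 * (\<Sum>\<mu> \<in># filter_mset (\<lambda>\<mu>. \<mu> < 0) (eigenvalues St). \<mu>) \<le> St \<bullet> Zs"
    using Z(4) sdp_feasible_quadratic_form_le[OF feas] by (rule inner_ge_negative_eigenvalues)
  have "p = (1/2) * (Zs \<bullet> W_mat A)"
    using symmetric_mat_W_mat[of A]
    by (simp add: p sdp_objective_def inner_eq_trace symmetric_mat_def)
  moreover have "A_adj (\<alpha>U, yU, \<alpha>V, yV) \<bullet> Zs = yU \<bullet> 1 + yV \<bullet> 1 + real k * (\<alpha>U + \<alpha>V)"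
    by (simp add: A_adj_adjoint Z(1) b_vec_def algebra_simps del: A_adj.simps)
  moreover have "B_adj cs t \<bullet> Zs \<le> 0"
    unfolding B_adj_adjoint(2)[OF symZ] using t Z(2)
    by (intro sum_nonpos mult_nonneg_nonpos) (auto simp: B_map_def)
  moreover have "0 \<le> Q \<bullet> Zs"
    using Q(2) Z(3) by (simp add: inner_vec_def entrywise_nonneg_def sum_nonneg)
  \<comment> \<open>The first term is \<open>- p\<close>, the second is the dual objective, and the
    last two contribute at most \<open>0\<close>. Hence \<open>p\<close> plus
    \<open>St \<bullet> Zs\<close> is at most the dual objective.\<close>
  moreover have "St \<bullet> Zs = - (1/2) * (Zs \<bullet> W_mat A) + A_adj (\<alpha>U, yU, \<alpha>V, yV) \<bullet> Zs
      + B_adj cs t \<bullet> Zs - Q \<bullet> Zs"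
    unfolding St by (simp add: inner_add_left inner_diff_left inner_commute[of Zs] del: A_adj.simps)
  ultimately show ?thesis
    using low by linarith
qed

end
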